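(* Let $\mathcal{P}$ be a regular 24-cell inscribed in a unit $4$-sphere, with $V$ vertices and $F$ facets. Let $k$ be the number of distinct chord lengths of $\mathcal{P}$ and let $d_1,\dots,d_k$ be these distinct chord lengths. Then $$\prod_{i=1}^{k}d_i^2=F=V .$$
   Context: A unit $4$-sphere here means a sphere of radius $1$ in $\mathbb{R}^4$; a regular polytope is inscribed in it if all its vertices lie on the sphere, whose center is the center of the polytope. The 24-cell is the regular convex polytope in $\mathbb{R}^4$ whose $3$-faces (facets) are 24 octahedra. A chord is a line segment whose endpoints are two distinct vertices of the polytope (so chords are all edges and all diagonals). *)

theory Defs
  imports "HOL-Analysis.Analysis"
begin

definition vertices :: "'a::euclidean_space set \<Rightarrow> 'a set" where
  "vertices P = {v. v extreme_point_of P}"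

definition facets :: "'a::euclidean_space set \<Rightarrow> 'a set set" where
  "facets P = {F. F facet_of P}"

definition symmetry_of :: "('a::euclidean_space \<Rightarrow> 'a) \<Rightarrow> 'a set \<Rightarrow> bool" where
  "symmetry_of f P \<longleftrightarrow> (\<forall>x y. dist (f x) (f y) = dist x y) \<and> f ` P = P"

text \<open>A flag is a maximal chain in the face lattice, so it always contains the improper
  faces \<^term>\<open>{}\<close> and \<^term>\<open>P\<close>.\<close>

definition flag_of :: "'a::euclidean_space set set \<Rightarrow> 'a set \<Rightarrow> bool" where
  "flag_of \<Phi> P \<longleftrightarrow> subset.maxchain {F. F face_of P} \<Phi>"

text \<open>Regularity of a convex polytope: its symmetry group is transitive on flags.\<close>

definition regular_polytope :: "'a::euclidean_space set \<Rightarrow> bool" where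
  "regular_polytope P \<longleftrightarrow> polytope P \<and>
     (\<forall>\<Phi> \<Psi>. flag_of \<Phi> P \<longrightarrow> flag_of \<Psi> P \<longrightarrow>
        (\<exists>f. symmetry_of f P \<and> (\<lambda>F. f ` F) ` \<Phi> = \<Psi>))"

text \<open>The regular octahedron is the three-dimensional cross-polytope, here placed
  anywhere in the ambient space with centre \<open>z\<close> and semi-axes \<open>a\<close>, \<open>b\<close>, \<open>c\<close>.\<close>

definition regular_octahedron :: "'a::euclidean_space set \<Rightarrow> bool" where
  "regular_octahedron K \<longleftrightarrow>
     (\<exists>z a b c. a \<noteq> 0 \<and> norm a = norm b \<and> norm b = norm c \<and>
        orthogonal a b \<and> orthogonal a c \<and> orthogonal b c \<and>
        K = convex hull {z + a, z - a, z + b, z - b, z + c, z - c})"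

text \<open>Facets of a regular polytope are themselves regular, so for a regular \<open>P\<close> it is no
  restriction to ask for regular octahedra.\<close>

definition regular_24_cell :: "(real^4) set \<Rightarrow> bool" where
  "regular_24_cell P \<longleftrightarrow> regular_polytope P \<and> aff_dim P = 4 \<and>
     card (facets P) = 24 \<and> (\<forall>F \<in> facets P. regular_octahedron F)"

text \<open>The centre of a regular polytope is the centroid of its vertices.\<close>

definition polytope_center :: "'a::euclidean_space set \<Rightarrow> 'a" where
  "polytope_center P = (\<Sum>v\<in>vertices P. v) /\<^sub>R real (card (vertices P))"

definition inscribed_in_sphere :: "'a::euclidean_space set \<Rightarrow> 'a \<Rightarrow> real \<Rightarrow> bool" where
  "inscribed_in_sphere P x r \<longleftrightarrow> vertices P \<subseteq> sphere x r \<and> x = polytope_center P"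

definition chord_lengths :: "'a::euclidean_space set \<Rightarrow> real set" where
  "chord_lengths P = {dist u v | u v. u \<in> vertices P \<and> v \<in> vertices P \<and> u \<noteq> v}"

end

theory Submission
  imports Defs
begin

text \<open>
  Put the centre of the polytope at the origin and look at one facet, an octahedron with centre
  \<open>z\<close> and semi-axes \<open>a\<close>, \<open>b\<close>, \<open>c\<close>. Its vertices have norm 1, so \<open>z\<close>, \<open>a\<close>, \<open>b\<close>, \<open>c\<close> are pairwise
  orthogonal. They form a basis, since \<open>z \<noteq> 0\<close>: the centroid of the vertices is not on a facet.

  The whole polytope can be recovered from this frame. Through each triangle of the facet there
  is a second facet, again a regular octahedron inscribed in the sphere, and this leaves only
  one possibility for it: the mirror image of the first one in the hyperplane spanned by the
  triangle and the origin (\<open>adjacent_cell\<close>). Successive facets around an edge therefore differ by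
  a rotation, whose angle depends on the size of the octahedron. By convexity the rotated
  facets close up after one full turn, which forces \<open>a \<bullet> a = z \<bullet> z = 1 / 2\<close> (\<open>cell_size\<close>): three
  octahedra meet at every edge.

  Now the frame consists of four orthogonal vectors of the same length, and passing to neighbours
  shows that each of the 24 vectors \<open>\<plusminus>z\<close>, \<open>\<plusminus>a\<close>, \<open>\<plusminus>b\<close>, \<open>\<plusminus>c\<close>, \<open>(\<plusminus>z \<plusminus> a \<plusminus> b \<plusminus> c) / 2\<close> is the centre
  of a facet. A unit vector that satisfies the corresponding 24 inequalities has two coordinates
  \<open>\<plusminus>1\<close> and two coordinates 0 in the frame, and all vectors of this kind are vertices of facets.
  Hence the vertices are the 24 roots of the root system \<open>D\<^sub>4\<close>, scaled to norm 1
  (\<open>vertices_eq_roots\<close>).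

  In this scale the squared distances of distinct roots are the integers 1, 2, 3, 4
  (\<open>chord_lengths_eq\<close>), and their product is 24.
\<close>

section \<open>Regular octahedra\<close>

definition semiaxes :: "'a::euclidean_space \<Rightarrow> 'a \<Rightarrow> 'a \<Rightarrow> bool" where
  "semiaxes a b c \<longleftrightarrow> a \<bullet> a > 0 \<and> b \<bullet> b = a \<bullet> a \<and> c \<bullet> c = a \<bullet> a \<and>
     a \<bullet> b = 0 \<and> a \<bullet> c = 0 \<and> b \<bullet> c = 0"

definition cross :: "'a::euclidean_space \<Rightarrow> 'a \<Rightarrow> 'a \<Rightarrow> 'a \<Rightarrow> 'a set" where
  "cross z a b c = {z + a, z - a, z + b, z - b, z + c, z - c}"

lemma regular_octahedron_iff_semiaxes:
  "regular_octahedron K \<longleftrightarrow> (\<exists>z a b c. semiaxes a b c \<and> K = convex hull (cross z a b c))"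
proof -
  have "semiaxes a b c \<longleftrightarrow> a \<noteq> 0 \<and> norm a = norm b \<and> norm b = norm c \<and>
        orthogonal a b \<and> orthogonal a c \<and> orthogonal b c" for a b c :: 'a
    unfolding semiaxes_def orthogonal_def norm_eq by auto
  then show ?thesis
    unfolding regular_octahedron_def cross_def by (simp only: conj_assoc)
qed

lemma finite_cross [simp]: "finite (cross z a b c)"
  by (simp add: cross_def)

lemma semiaxes_permute:
  "semiaxes a b c \<Longrightarrow> semiaxes b a c" "semiaxes a b c \<Longrightarrow> semiaxes a c b"
  "semiaxes a b c \<Longrightarrow> semiaxes (- a) b c"
  by (auto simp: semiaxes_def inner_commute)

lemma cross_permute:
  "cross z a b c = cross z b a c" "cross z a b c = cross z a c b"
  "cross z a b c = cross z (- a) b c"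
  by (auto simp: cross_def)

lemma not_in_convex_hull_if_separated:
  assumes "\<And>y. y \<in> S \<Longrightarrow> n \<bullet> y \<le> m" and "n \<bullet> v > m"
  shows "v \<notin> convex hull S"
proof -
  have "convex hull S \<subseteq> {y. n \<bullet> y \<le> m}"
    using assms(1) by (intro hull_minimal convex_halfspace_le) auto
  then show ?thesis using assms(2) by auto
qed

lemma cross_extreme_point:
  assumes "semiaxes a b c" and "v \<in> cross z a b c"
  shows "v extreme_point_of convex hull (cross z a b c)"
proof -
  have first: "z + a extreme_point_of convex hull (cross z a b c)" if "semiaxes a b c" for a b c
  proof -
    have "z + a \<notin> convex hull {z - a, z + b, z - b, z + c, z - c}"
      using that
      by (intro not_in_convex_hull_if_separated[where n = a and m = "a \<bullet> z"])
         (auto simp: semiaxes_def inner_simps)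
    then show ?thesis
      unfolding cross_def by (intro extreme_point_of_convex_hull_insert) auto
  qed
  have pair: "z + a extreme_point_of convex hull (cross z a b c) \<and>
      z - a extreme_point_of convex hull (cross z a b c)" if "semiaxes a b c" for a b c
    using first[OF that] first[OF semiaxes_permute(3)[OF that]] by (simp flip: cross_permute(3))
  have "z + b extreme_point_of convex hull (cross z a b c) \<and>
      z - b extreme_point_of convex hull (cross z a b c)"
    using pair[of b a c] assms(1) semiaxes_permute cross_permute by metis
  moreover have "z + c extreme_point_of convex hull (cross z a b c) \<and>
      z - c extreme_point_of convex hull (cross z a b c)"
    using pair[of c a b] assms(1) semiaxes_permute cross_permute by metis
  ultimately show ?thesis
    using pair[OF assms(1)] assms(2) unfolding cross_def by auto
qed

text \<open>The functional \<open>a + b + c\<close> separates the triangle from the opposite one, which consists of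
  the remaining three vertices.\<close>

lemma triangle_face_of_octahedron:
  assumes "semiaxes a b c"
  shows "convex hull {z + a, z + b, z + c} face_of convex hull (cross z a b c)"
proof (rule face_of_convex_hulls)
  let ?T = "{z + a, z + b, z + c}" and ?n = "a + b + c"
  show "?T \<subseteq> cross z a b c" by (auto simp: cross_def)
  have "affine hull ?T \<subseteq> {y. ?n \<bullet> y = ?n \<bullet> z + a \<bullet> a}"
    using assms by (intro hull_minimal affine_hyperplane)
      (auto simp: semiaxes_def inner_simps inner_commute)
  moreover have "convex hull (cross z a b c - ?T) \<subseteq> {y. ?n \<bullet> y \<le> ?n \<bullet> z - a \<bullet> a}"
    using assms by (intro hull_minimal convex_halfspace_le)
      (auto simp: cross_def semiaxes_def inner_simps inner_commute)
  moreover have "a \<bullet> a > 0" using assms by (simp add: semiaxes_def)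
  ultimately show "affine hull ?T \<inter> convex hull (cross z a b c - ?T) = {}"
    by (smt (verit) disjoint_iff mem_Collect_eq subsetD)
qed simp

lemma card_cross:
  assumes "semiaxes a b c"
  shows "card (cross z a b c) = 6"
proof -
  have neq: "v \<noteq> w \<and> v \<noteq> - w \<and> - v \<noteq> w \<and> - v \<noteq> - w \<and> v \<noteq> - v"
    if "v \<bullet> v > 0" "v \<bullet> w = 0" for v w :: 'a
  proof -
    have "u \<noteq> u'" if "v \<bullet> u \<noteq> v \<bullet> u'" for u u' :: 'a
      using that by auto
    from this[of v w] this[of v "- w"] this[of "- v" w] this[of "- v" "- w"] this[of v "- v"]
    show ?thesis using that by simp
  qed
  have "distinct [a, -a, b, -b, c, -c]"
    using neq[of a b] neq[of a c] neq[of b c] neq[of c c] neq[of c 0] assms unfolding semiaxes_def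
    by simp
  then have "distinct (map ((+) z) [a, -a, b, -b, c, -c])"
    by (subst distinct_map) auto
  then show ?thesis
    unfolding cross_def using distinct_card by fastforce
qed

text \<open>Two vertices of an octahedron are adjacent or antipodal, and antipodal ones are farther apart
  by a factor \<open>sqrt 2\<close>. Three equidistant vertices cannot be pairwise antipodal, so they
  lie on three different axes, and with the centre they determine the octahedron. This
  is how a facet is recognised from a triangle that it shares with a neighbour.\<close>

lemma cross_relabel:
  assumes axes: "semiaxes a' b' c'"
    and sub: "{p, q, r} \<subseteq> cross z a' b' c'"
    and dist: "(p - q) \<bullet> (p - q) = e" "(p - r) \<bullet> (p - r) = e" "(q - r) \<bullet> (q - r) = e" "e > 0"
  shows "semiaxes (p - z) (q - z) (r - z)"
    and "cross z a' b' c' = cross z (p - z) (q - z) (r - z)"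
proof -
  define n where "n = a' \<bullet> a'"
  have n: "n > 0" using axes by (simp add: semiaxes_def n_def)
  define E where "E = {a', -a', b', -b', c', -c'}"
  have E: "p - z \<in> E" "q - z \<in> E" "r - z \<in> E"
  proof -
    have "u - z \<in> E" if "u \<in> cross z a' b' c'" for u
      using that unfolding cross_def E_def by (elim insertE emptyE) simp_all
    then show "p - z \<in> E" "q - z \<in> E" "r - z \<in> E" using sub by auto
  qed
  have axis: "\<exists>e \<in> {a', b', c'}. u = e \<or> u = - e" if "u \<in> E" for u
    using that unfolding E_def by blast
  have axis_inner: "e \<bullet> f = n \<or> e \<bullet> f = 0" "e \<bullet> e = n" if "e \<in> {a', b', c'}" "f \<in> {a', b', c'}" for e f
    using that axes unfolding n_def semiaxes_def
    by (elim insertE emptyE; simp add: inner_commute)+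
  have EE: "u \<bullet> v = n \<or> u \<bullet> v = - n \<or> u \<bullet> v = 0" "u \<bullet> u = n" if uv: "u \<in> E" "v \<in> E" for u v
  proof -
    obtain e f where ef: "e \<in> {a', b', c'}" "f \<in> {a', b', c'}" "u = e \<or> u = - e" "v = f \<or> v = - f"
      using axis[OF uv(1)] axis[OF uv(2)] by blast
    show "u \<bullet> v = n \<or> u \<bullet> v = - n \<or> u \<bullet> v = 0" "u \<bullet> u = n"
      using axis_inner(1)[OF ef(1,2)] axis_inner(2)[OF ef(1,1)] ef(3,4) by auto
  qed
  have diff: "(u - v) \<bullet> (u - v) = u \<bullet> u + v \<bullet> v - 2 * (u \<bullet> v)" for u v :: 'a
    by (simp add: inner_simps inner_commute)
  let ?A = "p - z" and ?B = "q - z" and ?C = "r - z"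
  have e: "e = 2 * n - 2 * (?A \<bullet> ?B)" "e = 2 * n - 2 * (?A \<bullet> ?C)" "e = 2 * n - 2 * (?B \<bullet> ?C)"
    using diff[of ?A ?B] diff[of ?A ?C] diff[of ?B ?C] dist EE(2)[OF E(1,1)] EE(2)[OF E(2,2)] EE(2)[OF E(3,3)] by auto
  (* In the antipodal case all three products would be - n, and |A + B + C|^2 = - 3 n. *)
  have "(?A + ?B + ?C) \<bullet> (?A + ?B + ?C) = ?A \<bullet> ?A + ?B \<bullet> ?B + ?C \<bullet> ?C
          + 2 * (?A \<bullet> ?B) + 2 * (?A \<bullet> ?C) + 2 * (?B \<bullet> ?C)"
    by (simp add: inner_add_left inner_add_right inner_commute)
  also have "\<dots> = 3 * n + 6 * (?A \<bullet> ?B)"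
    using EE(2)[OF E(1,1)] EE(2)[OF E(2,2)] EE(2)[OF E(3,3)] e by simp
  finally have "3 * n + 6 * (?A \<bullet> ?B) \<ge> 0"
    using inner_ge_zero[of "?A + ?B + ?C"] by linarith
  then have "?A \<bullet> ?B = 0"
    using EE(1)[OF E(1,2)] e dist(4) n by auto
  then show sem: "semiaxes ?A ?B ?C"
    using EE(2)[OF E(1,1)] EE(2)[OF E(2,2)] EE(2)[OF E(3,3)] e n unfolding semiaxes_def by auto
  have "cross z ?A ?B ?C \<subseteq> cross z a' b' c'"
    using E unfolding cross_def E_def by (auto simp: algebra_simps)
  then show "cross z a' b' c' = cross z ?A ?B ?C"
    using card_cross[OF sem] card_cross[OF axes] by (metis card_subset_eq finite_cross)
qed

section \<open>Orthogonal frames and the root system of type D4\<close>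

lemma orthogonal_expansion:
  fixes e1 e2 e3 e4 w :: "real^4"
  assumes orth: "e1 \<bullet> e2 = 0" "e1 \<bullet> e3 = 0" "e1 \<bullet> e4 = 0" "e2 \<bullet> e3 = 0" "e2 \<bullet> e4 = 0" "e3 \<bullet> e4 = 0"
    and pos: "e1 \<bullet> e1 > 0" "e2 \<bullet> e2 > 0" "e3 \<bullet> e3 > 0" "e4 \<bullet> e4 > 0"
  shows "w = (w \<bullet> e1 / (e1 \<bullet> e1)) *\<^sub>R e1 + (w \<bullet> e2 / (e2 \<bullet> e2)) *\<^sub>R e2
           + (w \<bullet> e3 / (e3 \<bullet> e3)) *\<^sub>R e3 + (w \<bullet> e4 / (e4 \<bullet> e4)) *\<^sub>R e4"
proof -
  define s where "s = (w \<bullet> e1 / (e1 \<bullet> e1)) *\<^sub>R e1 + (w \<bullet> e2 / (e2 \<bullet> e2)) *\<^sub>R e2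
           + (w \<bullet> e3 / (e3 \<bullet> e3)) *\<^sub>R e3 + (w \<bullet> e4 / (e4 \<bullet> e4)) *\<^sub>R e4"
  define r where "r = w - s"
  have r: "r \<bullet> e1 = 0" "r \<bullet> e2 = 0" "r \<bullet> e3 = 0" "r \<bullet> e4 = 0"
    using orth pos by (auto simp: r_def s_def inner_simps inner_commute)
  have "r = 0"
  proof (rule ccontr)
    assume "r \<noteq> 0"
    then have rr: "r \<bullet> r > 0" by simp
    have ne: "u \<noteq> v" if "u \<bullet> v = 0" "u \<noteq> 0" for u v :: "real^4"
      using that by auto
    have "distinct [r, e1, e2, e3, e4]"
      using orth pos r \<open>r \<noteq> 0\<close> by (simp add: ne)
    then have "card {r, e1, e2, e3, e4} = 5"
      using distinct_card by fastforce
    moreover have "independent {r, e1, e2, e3, e4}"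
      using orth pos r rr
      by (intro pairwise_orthogonal_independent) (auto simp: pairwise_insert orthogonal_def inner_commute)
    ultimately show False
      using independent_bound[of "{r, e1, e2, e3, e4}"] by simp
  qed
  then show ?thesis by (simp add: r_def s_def)
qed

lemma inner_coordinates:
  fixes a b c z :: "'a::euclidean_space"
  assumes "semiaxes a b c" "z \<bullet> a = 0" "z \<bullet> b = 0" "z \<bullet> c = 0"
  shows "(p *\<^sub>R z + q *\<^sub>R a + r *\<^sub>R b + s *\<^sub>R c) \<bullet> (p' *\<^sub>R z + q' *\<^sub>R a + r' *\<^sub>R b + s' *\<^sub>R c)
    = p * p' * (z \<bullet> z) + (q * q' + r * r' + s * s') * (a \<bullet> a)"
  using assms by (simp add: semiaxes_def inner_simps inner_commute algebra_simps)

text \<open>The root system \<open>D\<^sub>4\<close>: the vectors with two entries \<open>\<plusminus>1\<close> and two entries 0.\<close>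

definition roots :: "(int \<times> int \<times> int \<times> int) set" where
  "roots = {(i, j, k, l). {i, j, k, l} \<subseteq> {-1, 0, 1} \<and> i\<^sup>2 + j\<^sup>2 + k\<^sup>2 + l\<^sup>2 = 2}"

lemma card_roots: "card roots = 24"
proof -
  have "roots = Set.filter (\<lambda>(i, j, k, l). i\<^sup>2 + j\<^sup>2 + k\<^sup>2 + l\<^sup>2 = 2)
     ({-1, 0, 1} \<times> {-1, 0, 1} \<times> {-1, 0, 1} \<times> {-1, 0, 1})"
    by (auto simp: roots_def)
  also have "card \<dots> = 24" by code_simp
  finally show ?thesis .
qed

fun lattice_point :: "'a::real_vector \<Rightarrow> 'a \<Rightarrow> 'a \<Rightarrow> 'a \<Rightarrow> int \<times> int \<times> int \<times> int \<Rightarrow> 'a" where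
  "lattice_point z a b c (i, j, k, l)
     = of_int i *\<^sub>R z + of_int j *\<^sub>R a + of_int k *\<^sub>R b + of_int l *\<^sub>R c"

section \<open>Facets and their neighbours\<close>

locale centred_octahedral_polytope =
  fixes P :: "(real^4) set" and x :: "real^4"
  assumes polytope: "polytope P" and full_dim: "aff_dim P = 4"
    and octahedral: "F facet_of P \<Longrightarrow> regular_octahedron F"
    and on_sphere: "vertices P \<subseteq> sphere x 1"
    and centroid: "x = polytope_center P"
begin

text \<open>A facet with its centre, seen from \<open>x\<close>, and with a choice of semi-axes. Recording the
  semi-axes keeps the positions of the six vertices at hand.\<close>

definition cell :: "real^4 \<Rightarrow> real^4 \<Rightarrow> real^4 \<Rightarrow> real^4 \<Rightarrow> bool" where
  "cell z a b c \<longleftrightarrow> semiaxes a b c \<and> convex hull (cross (x + z) a b c) facet_of P"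

lemma cell_permute:
  assumes "cell z a b c"
  shows "cell z b a c" "cell z a c b" "cell z (- a) b c"
  using assms semiaxes_permute[of a b c] cross_permute[of _ a b c] unfolding cell_def by metis+

lemma facet_is_cell:
  assumes "F facet_of P"
  obtains z a b c where "cell z a b c" "F = convex hull (cross (x + z) a b c)"
proof -
  obtain y a b c where *: "semiaxes a b c" "F = convex hull (cross y a b c)"
    using octahedral[OF assms] unfolding regular_octahedron_iff_semiaxes by blast
  with assms that[of "y - x" a b c] show thesis by (simp add: cell_def)
qed

lemma cell_vertex:
  assumes "cell z a b c" and "v \<in> cross (x + z) a b c"
  shows "v \<in> vertices P" and "v \<in> P"
proof -
  have "convex hull (cross (x + z) a b c) face_of P" "semiaxes a b c"
    using assms(1) by (auto simp: cell_def facet_of_imp_face_of)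
  then have "v extreme_point_of P"
    using cross_extreme_point[OF _ assms(2)] extreme_point_of_face by blast
  then show "v \<in> vertices P" "v \<in> P"
    by (auto simp: vertices_def extreme_point_of_def)
qed

text \<open>All six vertices \<open>z \<plusminus> a\<close>, \<open>z \<plusminus> b\<close>, \<open>z \<plusminus> c\<close> have norm 1. Comparing opposite ones shows that \<open>z\<close> is
  orthogonal to the semi-axes, and then Pythagoras applies.\<close>

lemma cell_metric:
  assumes "cell z a b c"
  shows "z \<bullet> a = 0" "z \<bullet> b = 0" "z \<bullet> c = 0" "z \<bullet> z + a \<bullet> a = 1"
proof -
  have unit: "(v - x) \<bullet> (v - x) = 1" if "v \<in> cross (x + z) a b c" for v
    using cell_vertex(1)[OF assms that] on_sphere
    by (auto simp: dist_norm norm_minus_commute simp flip: norm_eq_1)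
  have u: "(z + s) \<bullet> (z + s) = 1" if "s \<in> {a, -a, b, -b, c, -c}" for s
    using unit[of "x + z + s"] that by (auto simp: cross_def algebra_simps)
  show "z \<bullet> a = 0" "z \<bullet> b = 0" "z \<bullet> c = 0" "z \<bullet> z + a \<bullet> a = 1"
    using u[of a] u[of "-a"] u[of b] u[of "-b"] u[of c] u[of "-c"]
    by (simp_all add: inner_simps inner_commute)
qed

lemma finite_vertices: "finite (vertices P)"
  unfolding vertices_def
  by (rule finite_polyhedron_extreme_points[OF polytope_imp_polyhedron[OF polytope]])

lemma hull_vertices: "P = convex hull (vertices P)"
  unfolding vertices_def
  by (rule Krein_Milman_Minkowski[OF polytope_imp_compact[OF polytope] polytope_imp_convex[OF polytope]])

text \<open>The centroid could lie on a supporting hyperplane only if all vertices did, and then the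
  polytope would be flat.\<close>

lemma center_strictly_inside:
  assumes le: "P \<subseteq> {y. n \<bullet> y \<le> m}" and "n \<noteq> 0"
  shows "n \<bullet> x < m"
proof -
  have vle: "n \<bullet> v \<le> m" if "v \<in> vertices P" for v
    using that le by (auto simp: vertices_def extreme_point_of_def)
  have "\<exists>v \<in> vertices P. n \<bullet> v < m"
  proof (rule ccontr)
    assume "\<not> ?thesis"
    then have "vertices P \<subseteq> {y. n \<bullet> y = m}" using vle by force
    then have "convex hull (vertices P) \<subseteq> {y. n \<bullet> y = m}"
      by (intro hull_minimal convex_hyperplane)
    then have "aff_dim P \<le> aff_dim {y. n \<bullet> y = m}"
      using aff_dim_subset hull_vertices by metis
    then show False
      using full_dim \<open>n \<noteq> 0\<close> by simp
  qed
  then have "(\<Sum>v\<in>vertices P. n \<bullet> v) < (\<Sum>v\<in>vertices P. m)" and pos: "card (vertices P) > 0"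
    using vle finite_vertices by (blast intro!: sum_strict_mono_ex1, auto simp: card_gt_0_iff)
  moreover have "n \<bullet> x = (\<Sum>v\<in>vertices P. n \<bullet> v) / card (vertices P)"
    by (subst centroid) (simp add: polytope_center_def inner_sum_right divide_inverse_commute)
  ultimately show ?thesis
    using pos by (simp add: pos_divide_less_eq mult.commute)
qed

text \<open>A normal vector of a facet is orthogonal to the semi-axes, so in dimension 4 it is a multiple
  of the vector \<open>z\<close> from the centre of the polytope to the centre of the facet; the multiple is
  positive because the centre of the polytope is strictly inside.\<close>

lemma cell_supporting_halfspace:
  assumes "cell z a b c"
  shows "z \<bullet> z > 0" and "y \<in> P \<Longrightarrow> z \<bullet> (y - x) \<le> z \<bullet> z"
proof -
  have sem: "semiaxes a b c" and fac: "convex hull (cross (x + z) a b c) facet_of P"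
    using assms by (auto simp: cell_def)
  obtain n m where n: "n \<noteq> 0" "P \<subseteq> {y. n \<bullet> y \<le> m}"
      and F: "convex hull (cross (x + z) a b c) = P \<inter> {y. n \<bullet> y = m}"
    using facet_of_polyhedron[OF polytope_imp_polyhedron[OF polytope] fac] by metis
  have "n \<bullet> v = m" if "v \<in> cross (x + z) a b c" for v
    using F hull_inc[OF that, of convex] by auto
  then have "n \<bullet> (x + z + a) = m" "n \<bullet> (x + z - a) = m" "n \<bullet> (x + z + b) = m"
     "n \<bullet> (x + z - b) = m" "n \<bullet> (x + z + c) = m" "n \<bullet> (x + z - c) = m"
    by (auto simp: cross_def)
  then have na: "n \<bullet> a = 0" "n \<bullet> b = 0" "n \<bullet> c = 0" and nz: "n \<bullet> z = m - n \<bullet> x"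
    by (auto simp: inner_simps)
  have nzpos: "n \<bullet> z > 0"
    using center_strictly_inside[OF n(2,1)] nz by simp
  then show zz: "z \<bullet> z > 0"
    by auto
  have "n = (n \<bullet> z / (z \<bullet> z)) *\<^sub>R z + (n \<bullet> a / (a \<bullet> a)) *\<^sub>R a
      + (n \<bullet> b / (b \<bullet> b)) *\<^sub>R b + (n \<bullet> c / (c \<bullet> c)) *\<^sub>R c"
    using cell_metric[OF assms] sem zz by (intro orthogonal_expansion) (simp_all add: semiaxes_def)
  then have "n = (n \<bullet> z / (z \<bullet> z)) *\<^sub>R z"
    by (simp add: na)
  then have "n \<bullet> (y - x) = (n \<bullet> z / (z \<bullet> z)) * (z \<bullet> (y - x))"
    by (metis inner_scaleR_left)
  moreover have "n \<bullet> (y - x) \<le> n \<bullet> z" if "y \<in> P"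
    using n(2) that nz by (auto simp: inner_simps)
  ultimately show "z \<bullet> (y - x) \<le> z \<bullet> z" if "y \<in> P"
    using that nzpos zz by (simp add: field_simps)
qed

text \<open>A proper face of a polytope is the intersection of the facets that contain it. As a triangular
  face of a facet is smaller than the facet, a second facet contains it. All facets being
  regular octahedra, the shared triangle provides semi-axes for the second one.\<close>

lemma adjacent_cell_exists:
  assumes "cell z a b c"
  obtains z' where "z' \<noteq> z" "cell z' (z + a - z') (z + b - z') (z + c - z')"
proof -
  define F where "F = convex hull (cross (x + z) a b c)"
  define V where "V = {x + z + a, x + z + b, x + z + c}"
  have sem: "semiaxes a b c" and fac: "F facet_of P"
    using assms by (auto simp: cell_def F_def)
  have VF: "V \<subseteq> cross (x + z) a b c" by (auto simp: V_def cross_def)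
  have face: "convex hull V face_of P"
    using triangle_face_of_octahedron[OF sem, of "x + z"] fac face_of_trans facet_of_imp_face_of
    unfolding F_def V_def by blast
  have "x + z - a extreme_point_of F"
    using cross_extreme_point[OF sem] by (auto simp: F_def cross_def)
  moreover have "x + z - a \<notin> V"
  proof -
    have "a \<bullet> (x + z - a) < a \<bullet> (x + z)" "\<And>v. v \<in> V \<Longrightarrow> a \<bullet> v \<ge> a \<bullet> (x + z)"
      using sem by (auto simp: V_def semiaxes_def inner_simps)
    then show ?thesis by force
  qed
  ultimately have neF: "convex hull V \<noteq> F"
    using extreme_point_of_convex_hull by metis
  have sub: "convex hull V \<subseteq> F"
    unfolding F_def by (rule hull_mono[OF VF])
  then have neP: "convex hull V \<noteq> P"
    using facet_of_imp_subset[OF fac] fac facet_of_irrefl by (metis subset_antisym)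
  have ne: "convex hull V \<noteq> {}" by (simp add: V_def)
  have "convex hull V = \<Inter>{F. F facet_of P \<and> convex hull V \<subseteq> F}"
    by (rule face_of_polyhedron[OF polytope_imp_polyhedron[OF polytope] face ne neP])
  then have "{F. F facet_of P \<and> convex hull V \<subseteq> F} \<noteq> {F}"
    using neF by auto
  then obtain F' where F': "F' facet_of P" "convex hull V \<subseteq> F'" "F' \<noteq> F"
    using fac sub by blast
  obtain z' a' b' c' where c': "cell z' a' b' c'" "F' = convex hull (cross (x + z') a' b' c')"
    using facet_is_cell[OF F'(1)] by metis
  have sem': "semiaxes a' b' c'" using c' by (simp add: cell_def)
  have "v \<in> cross (x + z') a' b' c'" if "v \<in> V" for v
  proof -
    have "v extreme_point_of P"
      using cell_vertex(1)[OF assms] that VF by (auto simp: vertices_def)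
    moreover have "v \<in> F'" using F'(2) that hull_inc by fastforce
    ultimately have "v extreme_point_of F'"
      using F'(1) extreme_point_of_face facet_of_imp_face_of by blast
    then show ?thesis
      unfolding c'(2) by (rule extreme_point_of_convex_hull)
  qed
  then have V': "{x + z + a, x + z + b, x + z + c} \<subseteq> cross (x + z') a' b' c'"
    by (auto simp: V_def)
  have e: "(x + z + a - (x + z + b)) \<bullet> (x + z + a - (x + z + b)) = 2 * (a \<bullet> a)"
    "(x + z + a - (x + z + c)) \<bullet> (x + z + a - (x + z + c)) = 2 * (a \<bullet> a)"
    "(x + z + b - (x + z + c)) \<bullet> (x + z + b - (x + z + c)) = 2 * (a \<bullet> a)"
    "2 * (a \<bullet> a) > 0"
    using sem by (auto simp: semiaxes_def inner_simps inner_commute)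
  have shift: "x + z + u - (x + z') = z + u - z'" for u by simp
  note rel = cross_relabel[OF sem' V' e, unfolded shift]
  have cell': "cell z' (z + a - z') (z + b - z') (z + c - z')"
    using rel F'(1) unfolding cell_def c'(2) by simp
  moreover have "z' \<noteq> z"
    using rel(2) F'(3) c'(2) F_def by auto
  ultimately show thesis using that by blast
qed

text \<open>The second facet through a triangle is the mirror image of the first one in the hyperplane
  spanned by the triangle and the centre of the polytope. Both octahedra have the same edge
  length, hence centres of the same norm, and the centre \<open>z'\<close> of the second one has equal
  inner products with \<open>a\<close>, \<open>b\<close> and \<open>c\<close>. It therefore lies on a circle in the plane spanned by \<open>z\<close>
  and \<open>a + b + c\<close>, and on a line that meets this circle in \<open>z\<close> and in one other point. The
  coefficient of \<open>a + b + c\<close> in this point is \<open>\<beta>\<close>.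

  As the semi-axes of the neighbour have the same length, \<open>\<beta>\<close> is also the coefficient for the next
  step.\<close>

lemma adjacent_cell:
  assumes cell: "cell z a b c"
    and \<beta>: "\<beta> = 2 * (1 - a \<bullet> a) / (3 - 2 * (a \<bullet> a))"
    and z': "z' = (3 * \<beta> - 1) *\<^sub>R z + \<beta> *\<^sub>R (a + b + c)"
  shows "cell z' (z + a - z') (z + b - z') (z + c - z')"
    and "(z + a - z') \<bullet> (z + a - z') = a \<bullet> a"
proof -
  obtain y where y: "y \<noteq> z" and celly: "cell y (z + a - y) (z + b - y) (z + c - y)"
    using adjacent_cell_exists[OF cell] by metis
  define h t q where "h = z \<bullet> z" and "t = a \<bullet> a" and "q = y \<bullet> a"
  have h: "h > 0" using cell_supporting_halfspace(1)[OF cell] by (simp add: h_def)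
  have sem: "semiaxes a b c" using cell by (simp add: cell_def)
  then have t: "t > 0" "b \<bullet> b = t" "c \<bullet> c = t" by (auto simp: semiaxes_def t_def)
  note met = cell_metric[OF cell] and mety = cell_metric[OF celly]
  have ht: "h + t = 1" using met by (simp add: h_def t_def)
  have semy: "semiaxes (z + a - y) (z + b - y) (z + c - y)" using celly by (simp add: cell_def)
  let ?A = "z + a - y" and ?B = "z + b - y"
  (* The edge from z + a to z + b, common to both octahedra, fixes the length of the axes. *)
  have "(u - v) \<bullet> (u - v) = u \<bullet> u + v \<bullet> v - 2 * (u \<bullet> v)" for u v :: "real^4"
    by (simp add: inner_simps inner_commute)
  from this[of ?A ?B] have "(?A - ?B) \<bullet> (?A - ?B) = 2 * (?A \<bullet> ?A)"
    using semy unfolding semiaxes_def by linarith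
  moreover have "?A - ?B = a - b" by simp
  moreover have "(a - b) \<bullet> (a - b) = 2 * t"
    using sem by (simp add: semiaxes_def t_def inner_simps inner_commute)
  ultimately have AA: "?A \<bullet> ?A = t" by simp
  have yy: "y \<bullet> y = h" using mety(4) AA ht by simp
  have q: "y \<bullet> b = q" "y \<bullet> c = q" "y \<bullet> z = h - q"
    using mety(1-3) yy unfolding q_def by (auto simp: inner_simps)
  have yexp: "y = ((h - q) / h) *\<^sub>R z + (q / t) *\<^sub>R a + (q / t) *\<^sub>R b + (q / t) *\<^sub>R c"
    using orthogonal_expansion[of z a b c y] met sem h t q
    by (simp add: semiaxes_def h_def t_def q_def)
  have "q \<noteq> 0" using yexp h y by auto
  (* The norm of y in coordinates: a quadratic equation for q whose root q = 0 belongs to z. *)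
  have "h = ((h - q) / h) * ((h - q) / h) * h + 3 * ((q / t) * (q / t)) * t"
    using inner_coordinates[OF sem met(1-3), of "(h-q)/h" "q/t" "q/t" "q/t" "(h-q)/h" "q/t" "q/t" "q/t"]
    unfolding yexp[symmetric] yy h_def[symmetric] t_def[symmetric] by simp
  then have "(h * q) * (q * (t + 3 * h)) = (h * q) * (2 * h * t)"
    using h t by (simp add: field_simps power2_eq_square)
  then have "q * (t + 3 * h) = 2 * h * t"
    using \<open>q \<noteq> 0\<close> h by (simp only: mult_cancel_left) simp
  moreover have h1: "h = 1 - t" and t3: "3 - 2 * t > 0" using ht h t by auto
  ultimately have "q * (3 - 2 * t) = 2 * (1 - t) * t"
    by (simp add: algebra_simps)
  then have qb: "q = \<beta> * t"
    using t3 by (simp add: \<beta> eq_divide_eq flip: t_def)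
  have "(3 - 2 * t) * \<beta> = 2 * h"
    using t3 by (simp add: \<beta> h1 flip: t_def)
  then have "h - q = (3 * \<beta> - 1) * h"
    unfolding qb h1 by (simp add: algebra_simps)
  then have "(h - q) / h = 3 * \<beta> - 1"
    using h by simp
  then have "y = z'"
    using yexp t qb by (simp add: z' scaleR_add_right)
  then show "cell z' (z + a - z') (z + b - z') (z + c - z')"
    and "(z + a - z') \<bullet> (z + a - z') = a \<bullet> a"
    using celly AA t_def by auto
qed

text \<open>The facets around the edge from \<open>z + a\<close> to \<open>z + b\<close> arise from each other by a rotation that
  fixes the plane spanned by the edge and the centre of the polytope. The angle of the rotation
  depends on the size of the octahedra: it tends to about 109.5 degrees (the dihedral angle of
  the octahedron) for small ones and grows to 180 degrees as \<open>a \<bullet> a\<close> tends to 1. By convexity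
  the facets around an edge close up after one turn, so the angle divides 360 degrees. The only
  possible value is 120 degrees, which belongs to \<open>\<beta> = 1 / 2\<close> and \<open>a \<bullet> a = 1 / 2\<close>.

  In terms of inequalities, let \<open>y\<close> and \<open>w\<close> be the centres of the facets before and after the given
  one, and \<open>u\<close> the centre of the one after \<open>w\<close>. If the angle exceeded 120 degrees, a vertex of the
  facet \<open>w\<close> would lie beyond the facet \<open>y\<close>; if it were smaller, a vertex of the facet \<open>y\<close> would lie
  beyond the facet \<open>u\<close>.\<close>

lemma cell_size:
  assumes cell: "cell z a b c"
  shows "a \<bullet> a = 1 / 2" and "z \<bullet> z = 1 / 2"
proof -
  define h t where "h = z \<bullet> z" and "t = a \<bullet> a"
  define \<beta> where "\<beta> = 2 * (1 - t) / (3 - 2 * t)"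
  have h: "h > 0" using cell_supporting_halfspace(1)[OF cell] by (simp add: h_def)
  have sem: "semiaxes a b c" using cell by (simp add: cell_def)
  then have t: "t > 0" by (auto simp: semiaxes_def t_def)
  note met = cell_metric[OF cell]
  have ht: "h + t = 1" using met by (simp add: h_def t_def)
  then have \<beta>bounds: "\<beta> > 0" "3 * \<beta> < 2"
    using h t by (simp_all add: \<beta>_def field_simps)
  (* t and h are proportional to 2 - 3 \<beta> and \<beta>; this turns the inequalities below into polynomial ones. *)
  have t\<beta>: "(2 - 2 * \<beta>) * t = 2 - 3 * \<beta>"
    using ht h t by (simp add: \<beta>_def) (simp add: field_simps)
  then have h\<beta>: "(2 - 2 * \<beta>) * h = \<beta>"
    using ht by (simp add: algebra_simps flip: eq_diff_eq)
  have \<beta>1: "2 - 2 * \<beta> > 0" using \<beta>bounds by simp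
  define y where "y = (3 * \<beta> - 1) *\<^sub>R z + \<beta> *\<^sub>R (a + b + c)"
  define w where "w = (3 * \<beta> - 1) *\<^sub>R z + \<beta> *\<^sub>R (a + b - c)"
  define A B C where "A = z + a - w" and "B = z + b - w" and "C = z - c - w"
  have y: "cell y (z + a - y) (z + b - y) (z + c - y)"
    using adjacent_cell(1)[OF cell _ y_def] by (simp add: \<beta>_def t_def)
  have flip: "cell z a b (- c)"
    using cell cell_permute by metis
  have w: "cell w A B C" and AA: "A \<bullet> A = t"
    using adjacent_cell[OF flip, of \<beta> w] by (simp_all add: \<beta>_def t_def w_def A_def B_def C_def)
  have flip': "cell w A B (- C)"
    using w cell_permute by metis
  define u where "u = (3 * \<beta> - 1) *\<^sub>R w + \<beta> *\<^sub>R (A + B - C)"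
  have u: "cell u (w + A - u) (w + B - u) (w - C - u)"
    and uA: "(w + A - u) \<bullet> (w + A - u) = t"
    using adjacent_cell[OF flip', of \<beta> u] by (simp_all add: AA \<beta>_def u_def)
  define g where "g = 2 * \<beta> - 1"
  have y': "y = (3 * \<beta> - 1) *\<^sub>R z + \<beta> *\<^sub>R a + \<beta> *\<^sub>R b + \<beta> *\<^sub>R c"
    by (simp add: y_def algebra_simps)
  have u': "u = ((3 * \<beta> - 1) * g + \<beta>) *\<^sub>R z + (\<beta> * g + \<beta>) *\<^sub>R a + (\<beta> * g + \<beta>) *\<^sub>R b + (\<beta> - \<beta> * g) *\<^sub>R c"
    by (simp add: vec_eq_iff u_def A_def B_def C_def w_def g_def algebra_simps)
  note inner = inner_coordinates[OF sem met(1-3), folded h_def t_def]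
  (* Together with the edge, w - C spans the triangle in which the facets w and u meet. *)
  have "x + w - C \<in> P"
    using cell_vertex(2)[OF w] by (auto simp: cross_def)
  then have "y \<bullet> (w - C) \<le> y \<bullet> y"
    using cell_supporting_halfspace(2)[OF y] by (metis add_diff_eq add_diff_cancel_left')
  moreover have "w - C = (6 * \<beta> - 3) *\<^sub>R z + (2 * \<beta>) *\<^sub>R a + (2 * \<beta>) *\<^sub>R b + (1 - 2 * \<beta>) *\<^sub>R c"
    by (simp add: vec_eq_iff w_def C_def algebra_simps)
  ultimately have "(3 * \<beta> - 1) * (6 * \<beta> - 3) * h + (\<beta> * (2 * \<beta>) + \<beta> * (2 * \<beta>) + \<beta> * (1 - 2 * \<beta>)) * t
      \<le> (3 * \<beta> - 1) * (3 * \<beta> - 1) * h + (\<beta> * \<beta> + \<beta> * \<beta> + \<beta> * \<beta>) * t"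
    unfolding y' by (simp only: inner)
  from mult_left_mono[OF this less_imp_le[OF \<beta>1]]
  have "(3 * \<beta> - 1) * (6 * \<beta> - 3) * ((2 - 2 * \<beta>) * h)
        + (\<beta> * (2 * \<beta>) + \<beta> * (2 * \<beta>) + \<beta> * (1 - 2 * \<beta>)) * ((2 - 2 * \<beta>) * t)
      \<le> (3 * \<beta> - 1) * (3 * \<beta> - 1) * ((2 - 2 * \<beta>) * h)
        + (\<beta> * \<beta> + \<beta> * \<beta> + \<beta> * \<beta>) * ((2 - 2 * \<beta>) * t)"
    by (simp only: distrib_left mult.left_commute)
  then have "0 \<le> ((2 - 3 * \<beta>) * \<beta>) * (4 * \<beta> - 2)"
    unfolding t\<beta> h\<beta> by (simp add: algebra_simps)
  moreover have "(2 - 3 * \<beta>) * \<beta> > 0"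
    using \<beta>bounds by simp
  ultimately have lower: "\<beta> \<ge> 1 / 2"
    by (simp only: zero_le_mult_iff) linarith
  have uu: "u \<bullet> u = h"
    using cell_metric(4)[OF u] uA ht by simp
  (* Likewise the vertex of the facet y opposite to z + c, now tested against the facet u. *)
  have "x + y - (z + c - y) \<in> P"
    using cell_vertex(2)[OF y] by (auto simp: cross_def)
  then have "u \<bullet> (y - (z + c - y)) \<le> h"
    using cell_supporting_halfspace(2)[OF u] uu by (metis add_diff_eq add_diff_cancel_left')
  moreover have "y - (z + c - y) = (6 * \<beta> - 3) *\<^sub>R z + (2 * \<beta>) *\<^sub>R a + (2 * \<beta>) *\<^sub>R b + g *\<^sub>R c"
    by (simp add: vec_eq_iff y_def g_def algebra_simps)
  ultimately have "((3 * \<beta> - 1) * g + \<beta>) * (6 * \<beta> - 3) * h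
      + ((\<beta> * g + \<beta>) * (2 * \<beta>) + (\<beta> * g + \<beta>) * (2 * \<beta>) + (\<beta> - \<beta> * g) * g) * t \<le> h"
    unfolding u' by (simp only: inner)
  from mult_left_mono[OF this less_imp_le[OF \<beta>1]]
  have "((3 * \<beta> - 1) * g + \<beta>) * (6 * \<beta> - 3) * ((2 - 2 * \<beta>) * h)
      + ((\<beta> * g + \<beta>) * (2 * \<beta>) + (\<beta> * g + \<beta>) * (2 * \<beta>) + (\<beta> - \<beta> * g) * g) * ((2 - 2 * \<beta>) * t)
      \<le> (2 - 2 * \<beta>) * h"
    by (simp only: distrib_left mult.left_commute)
  then have "(4 * \<beta> * ((2 - 3 * \<beta>) * (1 - \<beta>))) * (2 * \<beta> - 1) \<le> 0"
    unfolding t\<beta> h\<beta> g_def by (simp add: algebra_simps)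
  moreover have "4 * \<beta> * ((2 - 3 * \<beta>) * (1 - \<beta>)) > 0"
    using \<beta>bounds by simp
  ultimately have "2 * \<beta> - 1 \<le> 0"
    by (metis mult_le_cancel_left_pos mult_zero_right)
  then have upper: "\<beta> \<le> 1 / 2"
    by simp
  with lower have "\<beta> = 1 / 2" by simp
  then show "a \<bullet> a = 1 / 2" and "z \<bullet> z = 1 / 2"
    using t\<beta> h\<beta> unfolding \<open>\<beta> = 1 / 2\<close> t_def h_def by simp_all
qed

section \<open>Vertices and chords\<close>

text \<open>With \<open>\<beta> = 1 / 2\<close> the passage to a neighbour multiplies the orthogonal frame \<open>z\<close>, \<open>a\<close>, \<open>b\<close>, \<open>c\<close> by
  half a symmetric Hadamard matrix of order 4.\<close>

lemma adjacent_cell_half: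
  assumes "cell z a b c"
  shows "cell ((1/2) *\<^sub>R (z + a + b + c)) ((1/2) *\<^sub>R (z + a - b - c))
    ((1/2) *\<^sub>R (z - a + b - c)) ((1/2) *\<^sub>R (z - a - b + c))"
proof -
  define y where "y = (1/2) *\<^sub>R (z + a + b + c)"
  have "cell y (z + a - y) (z + b - y) (z + c - y)"
    using adjacent_cell(1)[OF assms, of "1 / 2" y] cell_size[OF assms]
    by (simp add: y_def algebra_simps)
  moreover have "z + a - y = (1/2) *\<^sub>R (z + a - b - c)" "z + b - y = (1/2) *\<^sub>R (z - a + b - c)"
     "z + c - y = (1/2) *\<^sub>R (z - a - b + c)"
    by (simp_all add: vec_eq_iff y_def field_simps)
  ultimately show ?thesis by (simp add: y_def)
qed

text \<open>Two steps through neighbours lead from the facet with centre \<open>z\<close> to one with centre \<open>c\<close>; the signs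
  choose the neighbours.\<close>

lemma cell_swap:
  assumes "cell z a b c"
  shows "cell c a b z"
proof -
  let ?y = "(1/2) *\<^sub>R (z + a + b + c)" and ?A = "(1/2) *\<^sub>R (z + a - b - c)"
    and ?B = "(1/2) *\<^sub>R (z - a + b - c)" and ?C = "(1/2) *\<^sub>R (z - a - b + c)"
  have "cell ?y (- ?A) (- ?B) ?C"
    using adjacent_cell_half[OF assms] cell_permute by metis
  from adjacent_cell_half[OF this]
  have "cell ((1/2) *\<^sub>R (?y + - ?A + - ?B + ?C)) ((1/2) *\<^sub>R (?y + - ?A - - ?B - ?C))
    ((1/2) *\<^sub>R (?y - - ?A + - ?B - ?C)) ((1/2) *\<^sub>R (?y - - ?A - - ?B + ?C))" .
  moreover have "(1/2) *\<^sub>R (?y + - ?A + - ?B + ?C) = c" "(1/2) *\<^sub>R (?y + - ?A - - ?B - ?C) = b"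
    "(1/2) *\<^sub>R (?y - - ?A + - ?B - ?C) = a" "(1/2) *\<^sub>R (?y - - ?A - - ?B + ?C) = z"
    by (simp_all add: vec_eq_iff field_simps)
  ultimately have "cell c b a z" by metis
  then show ?thesis by (rule cell_permute)
qed

text \<open>The four vectors of the frame of one facet play symmetric roles: each of them and its negative
  is the centre of a facet, with the other three as semi-axes.\<close>

lemma cell_signed_permutations:
  assumes "cell z a b c"
  shows "cell z b a c" "cell z a c b" "cell c a b z" "cell a z b c" "cell b a z c"
    "cell (- z) a b c" "cell z (- a) b c" "cell z a (- b) c" "cell z a b (- c)"
  using assms cell_permute cell_swap by metis+

text \<open>The supporting halfspaces at the centres \<open>\<plusminus>z\<close> give the first bound, and those at the sixteen
  centres \<open>(\<plusminus>z \<plusminus> a \<plusminus> b \<plusminus> c) / 2\<close> together give the second one.\<close>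

lemma cell_center_inner_bounds:
  assumes cell: "cell z a b c" and "y \<in> P"
  shows "\<bar>z \<bullet> (y - x)\<bar> \<le> 1 / 2"
    and "\<bar>z \<bullet> (y - x)\<bar> + \<bar>a \<bullet> (y - x)\<bar> + \<bar>b \<bullet> (y - x)\<bar> + \<bar>c \<bullet> (y - x)\<bar> \<le> 1"
proof -
  have le: "v \<bullet> (y - x) \<le> 1 / 2" if "cell v p q r" for v p q r
    using cell_supporting_halfspace(2)[OF that \<open>y \<in> P\<close>] cell_size[OF that] by simp
  show "\<bar>z \<bullet> (y - x)\<bar> \<le> 1 / 2"
    using le[OF cell] le[OF cell_signed_permutations(6)[OF cell]] by simp
  have sum: "v \<bullet> (y - x) + p \<bullet> (y - x) + q \<bullet> (y - x) + r \<bullet> (y - x) \<le> 1" if "cell v p q r" for v p q r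
    using le[OF adjacent_cell_half[OF that]]
    by (simp only: inner_scaleR_left inner_add_left) simp
  define s where "s v = (if v \<bullet> (y - x) < 0 then - v else v)" for v
  have s: "s v \<bullet> (y - x) = \<bar>v \<bullet> (y - x)\<bar>" for v by (simp add: s_def)
  have "cell (s z) (s a) (s b) (s c)"
    unfolding s_def using cell cell_signed_permutations(6-9) by presburger
  from sum[OF this] show "\<bar>z \<bullet> (y - x)\<bar> + \<bar>a \<bullet> (y - x)\<bar> + \<bar>b \<bullet> (y - x)\<bar> + \<bar>c \<bullet> (y - x)\<bar> \<le> 1"
    by (simp add: s)
qed

lemma lattice_point_inner:
  assumes "cell z a b c"
  shows "lattice_point z a b c (i, j, k, l) \<bullet> lattice_point z a b c (i', j', k', l')
    = of_int (i * i' + j * j' + k * k' + l * l') / 2"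
  using inner_coordinates[of a b c z] assms cell_metric[OF assms] cell_size[OF assms]
  by (simp add: cell_def field_simps)

text \<open>Let \<open>i\<close>, \<open>j\<close>, \<open>k\<close>, \<open>l\<close> be the coordinates of a vertex in the frame. As its norm is 1, their squares
  add up to 2, while the facet inequalities bound each absolute value by 1 and the sum of the
  absolute values by 2. Since \<open>i\<^sup>2 \<le> \<bar>i\<bar>\<close> for each coordinate, equality holds everywhere, and every
  coordinate is 0 or \<open>\<plusminus>1\<close>.\<close>

lemma vertex_is_root:
  assumes cell: "cell z a b c" and v: "v \<in> vertices P"
  shows "v \<in> (\<lambda>r. x + lattice_point z a b c r) ` roots"
proof -
  have vP: "v \<in> P" using v by (auto simp: vertices_def extreme_point_of_def)
  define w where "w = v - x"
  have ww: "w \<bullet> w = 1"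
    using v on_sphere by (auto simp: w_def dist_norm norm_minus_commute simp flip: norm_eq_1)
  note size = cell_size[OF cell] and met = cell_metric[OF cell]
  have sem: "semiaxes a b c" using cell by (simp add: cell_def)
  have w: "w = (2 * (w \<bullet> z)) *\<^sub>R z + (2 * (w \<bullet> a)) *\<^sub>R a + (2 * (w \<bullet> b)) *\<^sub>R b + (2 * (w \<bullet> c)) *\<^sub>R c"
  proof -
    have half: "z \<bullet> z = 1 / 2" "a \<bullet> a = 1 / 2" "b \<bullet> b = 1 / 2" "c \<bullet> c = 1 / 2"
      using size sem by (auto simp: semiaxes_def)
    moreover have "a \<bullet> b = 0" "a \<bullet> c = 0" "b \<bullet> c = 0"
      using sem by (auto simp: semiaxes_def)
    ultimately show ?thesis
      using orthogonal_expansion[of z a b c w, unfolded half] met by (simp add: mult.commute)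
  qed
  define i j k l where "i = 2 * (w \<bullet> z)" and "j = 2 * (w \<bullet> a)" and "k = 2 * (w \<bullet> b)" and "l = 2 * (w \<bullet> c)"
  have wl: "w = i *\<^sub>R z + j *\<^sub>R a + k *\<^sub>R b + l *\<^sub>R c"
    using w by (simp add: i_def j_def k_def l_def)
  have sq: "i * i + j * j + k * k + l * l = 2"
    using inner_coordinates[OF sem met(1-3), of i j k l i j k l] size ww
    unfolding wl[symmetric] size ww by (simp add: field_simps)
  have abs: "\<bar>i\<bar> \<le> 1" "\<bar>j\<bar> \<le> 1" "\<bar>k\<bar> \<le> 1" "\<bar>l\<bar> \<le> 1"
    using cell_center_inner_bounds(1)[OF cell vP]
      cell_center_inner_bounds(1)[OF cell_signed_permutations(4)[OF cell] vP]
      cell_center_inner_bounds(1)[OF cell_signed_permutations(5)[OF cell] vP]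
      cell_center_inner_bounds(1)[OF cell_signed_permutations(3)[OF cell] vP]
    unfolding i_def j_def k_def l_def w_def by (simp_all add: inner_commute abs_mult)
  have sum: "\<bar>i\<bar> + \<bar>j\<bar> + \<bar>k\<bar> + \<bar>l\<bar> \<le> 2"
    using cell_center_inner_bounds(2)[OF cell vP]
    unfolding i_def j_def k_def l_def w_def by (simp add: inner_commute abs_mult)
  have "\<bar>i\<bar> * (1 - \<bar>i\<bar>) + \<bar>j\<bar> * (1 - \<bar>j\<bar>) + \<bar>k\<bar> * (1 - \<bar>k\<bar>) + \<bar>l\<bar> * (1 - \<bar>l\<bar>) \<le> 0"
    using sum sq by (simp add: algebra_simps)
  moreover have "\<bar>i\<bar> * (1 - \<bar>i\<bar>) \<ge> 0" "\<bar>j\<bar> * (1 - \<bar>j\<bar>) \<ge> 0" "\<bar>k\<bar> * (1 - \<bar>k\<bar>) \<ge> 0" "\<bar>l\<bar> * (1 - \<bar>l\<bar>) \<ge> 0"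
    using abs by simp_all
  ultimately have "\<bar>i\<bar> * (1 - \<bar>i\<bar>) = 0" "\<bar>j\<bar> * (1 - \<bar>j\<bar>) = 0" "\<bar>k\<bar> * (1 - \<bar>k\<bar>) = 0" "\<bar>l\<bar> * (1 - \<bar>l\<bar>) = 0"
    by linarith+
  then have vals: "i \<in> {-1, 0, 1}" "j \<in> {-1, 0, 1}" "k \<in> {-1, 0, 1}" "l \<in> {-1, 0, 1}"
    by auto
  then obtain i' j' k' l' :: int where ints: "{i', j', k', l'} \<subseteq> {-1, 0, 1}"
    "i = of_int i'" "j = of_int j'" "k = of_int k'" "l = of_int l'"
  proof -
    have "\<exists>m :: int. m \<in> {-1, 0, 1} \<and> s = of_int m" if "s \<in> {-1, 0, 1}" for s :: real
      using that by (auto intro: exI[of _ "-1"] exI[of _ 0] exI[of _ 1])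
    from this[OF vals(1)] this[OF vals(2)] this[OF vals(3)] this[OF vals(4)] show thesis
      using that by blast
  qed
  have "real_of_int (i'\<^sup>2 + j'\<^sup>2 + k'\<^sup>2 + l'\<^sup>2) = real_of_int 2"
    using sq unfolding ints(2-5) by (simp add: power2_eq_square)
  then have "i'\<^sup>2 + j'\<^sup>2 + k'\<^sup>2 + l'\<^sup>2 = 2"
    by (simp only: of_int_eq_iff)
  then have "(i', j', k', l') \<in> roots"
    using ints(1) by (simp add: roots_def)
  moreover have "v = x + lattice_point z a b c (i', j', k', l')"
    using wl unfolding ints(2-5) w_def by (simp add: algebra_simps)
  ultimately show ?thesis by blast
qed

text \<open>A root is \<open>\<plusminus>p \<plusminus> q\<close> for two vectors \<open>p\<close> and \<open>q\<close> of the frame, hence a vertex of the facet with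
  centre \<open>\<plusminus>p\<close>.\<close>

lemma root_is_vertex:
  assumes cell: "cell z a b c" and "r \<in> roots"
  shows "x + lattice_point z a b c r \<in> vertices P"
proof -
  have V: "x + (p + q) \<in> vertices P" if "cell p q s t" for p q s t
    using cell_vertex(1)[OF that] by (simp add: cross_def add.assoc)
  have V4: "x + (p + q) \<in> vertices P" "x + (p - q) \<in> vertices P"
     "x + (q - p) \<in> vertices P" "x + (- p - q) \<in> vertices P" if "cell p q s t" for p q s t
    using V[of p q s t] V[of "- p" q s t] V[of p "- q" s t] V[of "- p" "- q" s t] that
      cell_signed_permutations(6,7) by force+
  have pairs: "cell z a b c" "cell z b a c" "cell z c a b" "cell a b z c" "cell a c z b" "cell b c z a"
    using cell cell_signed_permutations(1-5) by metis+
  obtain i j k l where r: "r = (i, j, k, l)" by (cases r) auto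
  have "i \<in> {-1, 0, 1}" "j \<in> {-1, 0, 1}" "k \<in> {-1, 0, 1}" "l \<in> {-1, 0, 1}" "i\<^sup>2 + j\<^sup>2 + k\<^sup>2 + l\<^sup>2 = 2"
    using assms(2) by (auto simp: r roots_def)
  then show ?thesis
    unfolding r lattice_point.simps
    by (elim insertE emptyE)
      (simp_all add: V4[OF pairs(1)] V4[OF pairs(2)] V4[OF pairs(3)]
        V4[OF pairs(4)] V4[OF pairs(5)] V4[OF pairs(6)])
qed

lemma vertices_eq_roots:
  assumes "cell z a b c"
  shows "vertices P = (\<lambda>r. x + lattice_point z a b c r) ` roots"
  using vertex_is_root[OF assms] root_is_vertex[OF assms] by blast

lemma cell_exists: obtains z a b c where "cell z a b c"
  using polytope_facet_exists[OF polytope] full_dim facet_is_cell by (metis zero_less_numeral)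

lemma card_vertices: "card (vertices P) = 24"
proof -
  obtain z a b c where cell: "cell z a b c" by (rule cell_exists)
  have "inj_on (\<lambda>r. x + lattice_point z a b c r) roots"
  proof (rule inj_onI, unfold split_paired_all)
    fix i j k l i' j' k' l' :: int
    assume "x + lattice_point z a b c (i, j, k, l) = x + lattice_point z a b c (i', j', k', l')"
    then have "lattice_point z a b c (i, j, k, l) \<bullet> lattice_point z a b c s
      = lattice_point z a b c (i', j', k', l') \<bullet> lattice_point z a b c s" for s by (simp del: lattice_point.simps)
    from this[of "(1, 0, 0, 0)"] this[of "(0, 1, 0, 0)"] this[of "(0, 0, 1, 0)"] this[of "(0, 0, 0, 1)"]
    show "(i, j, k, l) = (i', j', k', l')"
      unfolding lattice_point_inner[OF cell] by simp
  qed
  then show ?thesis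
    unfolding vertices_eq_roots[OF cell] by (simp add: card_image card_roots)
qed

text \<open>Seen from the centre, two vertices have an inner product in \<open>\<int> / 2\<close>, so a squared chord length is an integer;
  it lies between 1 and 4 because the diameter of the sphere is 2. The chords from the root
  \<open>(1, 1, 0, 0)\<close> attain all four values.\<close>

lemma chord_lengths_eq: "chord_lengths P = sqrt ` {1, 2, 3, 4}"
proof -
  obtain z a b c where cell: "cell z a b c" by (rule cell_exists)
  let ?v = "\<lambda>r. x + lattice_point z a b c r"
  have dist_sq: "(dist (?v (i, j, k, l)) (?v (i', j', k', l')))\<^sup>2 = of_int (2 - (i * i' + j * j' + k * k' + l * l'))"
    if "(i, j, k, l) \<in> roots" "(i', j', k', l') \<in> roots" for i j k l i' j' k' l'
  proof -
    let ?p = "lattice_point z a b c (i, j, k, l)" and ?q = "lattice_point z a b c (i', j', k', l')"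
    have "(dist (?v (i, j, k, l)) (?v (i', j', k', l')))\<^sup>2 = ?p \<bullet> ?p + ?q \<bullet> ?q - 2 * (?p \<bullet> ?q)"
      by (simp add: dist_norm power2_norm_eq_inner inner_diff_left inner_diff_right inner_commute
        del: lattice_point.simps)
    moreover have "i * i + j * j + k * k + l * l = 2" "i' * i' + j' * j' + k' * k' + l' * l' = 2"
      using that by (auto simp: roots_def power2_eq_square)
    moreover from this have "?p \<bullet> ?p = 1" "?q \<bullet> ?q = 1"
      unfolding lattice_point_inner[OF cell] by simp_all
    ultimately show ?thesis
      by (simp add: lattice_point_inner[OF cell] del: lattice_point.simps of_int_add of_int_mult)
  qed
  show ?thesis
  proof
    show "chord_lengths P \<subseteq> sqrt ` {1, 2, 3, 4}"
    proof
      fix d assume "d \<in> chord_lengths P"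
      then obtain u v where uv: "u \<in> vertices P" "v \<in> vertices P" "u \<noteq> v" "d = dist u v"
        by (auto simp: chord_lengths_def)
      then obtain i j k l i' j' k' l' where "(i, j, k, l) \<in> roots" "(i', j', k', l') \<in> roots"
        "u = ?v (i, j, k, l)" "v = ?v (i', j', k', l')"
        unfolding vertices_eq_roots[OF cell] by auto
      then obtain m :: int where m: "d\<^sup>2 = of_int m"
        using dist_sq uv(4) by metis
      have d: "0 < d" using uv by simp
      have "d \<le> dist u x + dist v x"
        unfolding uv(4) by (rule dist_triangle2)
      also have "\<dots> = 2"
        using subsetD[OF on_sphere uv(1)] subsetD[OF on_sphere uv(2)] by (simp add: dist_commute)
      finally have "d\<^sup>2 \<le> 2\<^sup>2"
        using d by (intro power_mono) auto
      moreover have "0 < d\<^sup>2" using d by simp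
      ultimately have "0 < m" "m \<le> 4"
        unfolding m by simp_all
      then have "m = 1 \<or> m = 2 \<or> m = 3 \<or> m = 4" by linarith
      moreover have "d = sqrt (of_int m)"
        using m d by (simp add: real_sqrt_unique)
      ultimately show "d \<in> sqrt ` {1, 2, 3, 4}" by auto
    qed
    have chord: "sqrt (of_int m) \<in> chord_lengths P"
      if "(i, j, k, l) \<in> roots" "m = 2 - (i + j)" "m > 0" for m i j k l
    proof -
      let ?u = "?v (i, j, k, l)" and ?w = "?v (1, 1, 0, 0)"
      have base: "(1, 1, 0, 0) \<in> roots" by (simp add: roots_def)
      have "(dist ?u ?w)\<^sup>2 = of_int m"
        using dist_sq[OF that(1) base] that(2) by simp
      then have "dist ?u ?w = sqrt (of_int m)"
        by (metis real_sqrt_unique zero_le_dist)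
      moreover from this have "?u \<noteq> ?w"
        using that(3) by auto
      moreover have "?u \<in> vertices P" "?w \<in> vertices P"
        using root_is_vertex[OF cell] that(1) base by blast+
      ultimately show ?thesis
        unfolding chord_lengths_def mem_Collect_eq by metis
    qed
    show "sqrt ` {1, 2, 3, 4} \<subseteq> chord_lengths P"
      using chord[of 1 0 1 0 1] chord[of 0 0 1 1 2] chord[of "-1" 0 1 0 3] chord[of "-1" "-1" 0 0 4]
      by (simp add: roots_def)
  qed
qed

end

theorem theorem6p3:
  fixes P :: "(real^4) set" and x :: "real^4" and V F k :: nat and d :: "nat \<Rightarrow> real"
  assumes "regular_24_cell P"
    and "inscribed_in_sphere P x 1"
    and "V = card (vertices P)"
    and "F = card (facets P)"
    and "k = card (chord_lengths P)"
    and "bij_betw d {1..k} (chord_lengths P)"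
  shows "(\<Prod>i=1..k. (d i)\<^sup>2) = real F \<and> F = V"
proof -
  interpret centred_octahedral_polytope P x
    using assms(1,2)
    by unfold_locales
      (auto simp: regular_24_cell_def regular_polytope_def facets_def inscribed_in_sphere_def)
  have "(\<Prod>i=1..k. (d i)\<^sup>2) = (\<Prod>l\<in>chord_lengths P. l\<^sup>2)"
    by (rule prod.reindex_bij_betw[OF assms(6)])
  also have "\<dots> = (\<Prod>s\<in>{1, 2, 3, 4}. (sqrt s)\<^sup>2)"
    unfolding chord_lengths_eq by (subst prod.reindex) (auto simp: inj_on_def)
  also have "\<dots> = 24"
    by simp
  finally show ?thesis
    using assms(1,3,4) card_vertices by (simp add: regular_24_cell_def)
qed

end
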